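(* Let $k\ge 2$ and $e\ge 3$. If there exists a $k$-chromatic $e$-star system of order $n_0$ with $n_0\equiv 0$ or $1\pmod{2e}$, then there exists a $k$-chromatic $e$-star system of order $n$ for every $n>n_0$ with $n\equiv 0$ or $1\pmod{2e}$.
   Context: An $e$-star is the complete bipartite graph $K_{1,e}$. An $e$-star system of order $n$ is a pair $(V,\mathcal B)$ where $|V|=n$ and $\mathcal B$ is a set of $e$-stars (subgraphs of the complete graph $K_n$ on $V$) whose edge sets partition the edge set of $K_n$. An $e$-star system is $k$-colourable if $V$ can be partitioned into $k$ sets (colour classes) such that no star in $\mathcal B$ has all its vertices in the same class; it is $k$-chromatic if it is $k$-colourable but not $(k-1)$-colourable. *)

theory Defs
  imports Main "HOL-Library.Disjoint_Sets" "HOL-Number_Theory.Cong"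
begin

text \<open>A (simple) graph is a pair of a vertex set and a set of edges, an edge being a
  two-element set of vertices.\<close>

type_synonym 'a sgraph = "'a set \<times> 'a set set"

abbreviation verts :: "'a sgraph \<Rightarrow> 'a set" where
  "verts G \<equiv> fst G"

abbreviation edges :: "'a sgraph \<Rightarrow> 'a set set" where
  "edges G \<equiv> snd G"

definition complete_graph :: "'a set \<Rightarrow> 'a sgraph" where
  "complete_graph V = (V, {F. F \<subseteq> V \<and> card F = 2})"

definition subgraph :: "'a sgraph \<Rightarrow> 'a sgraph \<Rightarrow> bool" where
  "subgraph H G \<longleftrightarrow> verts H \<subseteq> verts G \<and> edges H \<subseteq> edges G"

definition complete_bipartite_graph :: "'a set \<Rightarrow> 'a set \<Rightarrow> 'a sgraph" where
  "complete_bipartite_graph X Y = (X \<union> Y, {{x, y} | x y. x \<in> X \<and> y \<in> Y})"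

definition is_star :: "nat \<Rightarrow> 'a sgraph \<Rightarrow> bool" where
  "is_star e S \<longleftrightarrow>
     (\<exists>c L. c \<notin> L \<and> finite L \<and> card L = e \<and> S = complete_bipartite_graph {c} L)"

definition star_system :: "nat \<Rightarrow> nat \<Rightarrow> 'a set \<Rightarrow> 'a sgraph set \<Rightarrow> bool" where
  "star_system e n V B \<longleftrightarrow>
     finite V \<and> card V = n \<and>
     (\<forall>S\<in>B. is_star e S \<and> subgraph S (complete_graph V)) \<and>
     disjoint_family_on edges B \<and>
     (\<Union>S\<in>B. edges S) = edges (complete_graph V)"

text \<open>\<^const>\<open>partition_on\<close> asks for nonempty colour classes. Being k-chromatic, for
  k at least 2, means the same whether or not empty classes are allowed: nonempty classes can
  be split further as long as there are at most as many classes as vertices.\<close>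

definition colourable :: "nat \<Rightarrow> 'a set \<Rightarrow> 'a sgraph set \<Rightarrow> bool" where
  "colourable k V B \<longleftrightarrow>
     (\<exists>P. partition_on V P \<and> finite P \<and> card P = k \<and> (\<forall>S\<in>B. \<forall>C\<in>P. \<not> verts S \<subseteq> C))"

definition chromatic :: "nat \<Rightarrow> 'a set \<Rightarrow> 'a sgraph set \<Rightarrow> bool" where
  "chromatic k V B \<longleftrightarrow> colourable k V B \<and> \<not> colourable (k - 1) V B"

end

theory Submission
  imports Defs
begin

text \<open>
  New vertices are added to a system on \<open>V\<close> as centres only: each new vertex \<open>x\<close> is joined to all of
  \<open>V\<close> and to its out-neighbours in a tournament on the new vertices. One new vertex leads from order
  \<open>2et\<close> to \<open>2et + 1\<close>; a regular tournament on \<open>2e - 1\<close> new vertices leads from \<open>2et + 1\<close> to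
  \<open>2e(t + 1)\<close>, as \<open>(2et + 1) + (e - 1) = e(2t + 1)\<close>. All new vertices receive the same colour, one
  used on at most half of \<open>V\<close>; then there are enough vertices of other colours to put one
  into every new star. The old system is contained in the new one, so no colour can be saved.
\<close>

section \<open>Colourings as functions\<close>

text \<open>The number of colours is kept apart, as the size of the image of the vertex set, so that
  one function can serve a system and any subsystem.\<close>

definition proper_colouring :: "('a \<Rightarrow> 'c) \<Rightarrow> 'a sgraph set \<Rightarrow> bool" where
  "proper_colouring f B \<longleftrightarrow> (\<forall>S\<in>B. \<exists>u\<in>verts S. \<exists>v\<in>verts S. f u \<noteq> f v)"

text \<open>Classes are the fibres of \<open>f\<close> on \<open>V\<close>. Since
  \<open>partition_on\<close> admits only nonempty classes, exactly \<open>k\<close> colours must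
  occur, hence an equation for the size of the image.\<close>

lemma colourable_iff_proper_colouring:
  fixes V :: "'a set"
  assumes "finite V" and B: "\<And>S. S \<in> B \<Longrightarrow> verts S \<subseteq> V \<and> verts S \<noteq> {}"
  shows "colourable k V B \<longleftrightarrow> (\<exists>f :: 'a \<Rightarrow> nat. card (f ` V) = k \<and> proper_colouring f B)"
proof
  assume "colourable k V B"
  then obtain P where P: "partition_on V P" "finite P" "card P = k"
    and mono: "\<And>S C. S \<in> B \<Longrightarrow> C \<in> P \<Longrightarrow> \<not> verts S \<subseteq> C"
    unfolding colourable_def by blast
  obtain h :: "'a set \<Rightarrow> nat" where h: "inj_on h P"
    using finite_imp_inj_to_nat_seg[OF P(2)] by blast
  have "\<exists>C. C \<in> P \<and> v \<in> C" if "v \<in> V" for v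
    using that partition_onD1[OF P(1)] by blast
  then obtain cl where cl: "\<And>v. v \<in> V \<Longrightarrow> cl v \<in> P \<and> v \<in> cl v"
    by metis
  have cl_eq: "cl v = C" if "C \<in> P" "v \<in> C" for v C
  proof -
    have "v \<in> V" using that partition_onD1[OF P(1)] by blast
    then show ?thesis
      using cl[of v] that partition_onD2[OF P(1)] unfolding disjoint_def by blast
  qed
  have img: "cl ` V = P"
  proof
    show "P \<subseteq> cl ` V"
    proof
      fix C assume C: "C \<in> P"
      then obtain v where v: "v \<in> C" using partition_onD3[OF P(1)] by (metis ex_in_conv)
      with C partition_onD1[OF P(1)] have "v \<in> V" by blast
      with cl_eq[OF C v] show "C \<in> cl ` V" by blast
    qed
  qed (use cl in blast)
  have "proper_colouring (h \<circ> cl) B"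
    unfolding proper_colouring_def
  proof
    fix S assume S: "S \<in> B"
    then obtain u where u: "u \<in> verts S" "u \<in> V" using B by blast
    then obtain v where v: "v \<in> verts S" "v \<notin> cl u" using mono[OF S] cl by blast
    then have "v \<in> V" using S B by blast
    with v u cl have "cl u \<noteq> cl v" "cl u \<in> P" "cl v \<in> P" by auto
    then have "(h \<circ> cl) u \<noteq> (h \<circ> cl) v" using h by (auto dest: inj_onD)
    with u v show "\<exists>u\<in>verts S. \<exists>v\<in>verts S. (h \<circ> cl) u \<noteq> (h \<circ> cl) v" by blast
  qed
  moreover have "card ((h \<circ> cl) ` V) = k"
    using img h P(3) by (metis card_image image_comp)
  ultimately show "\<exists>f :: 'a \<Rightarrow> nat. card (f ` V) = k \<and> proper_colouring f B" by blast
next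
  assume "\<exists>f :: 'a \<Rightarrow> nat. card (f ` V) = k \<and> proper_colouring f B"
  then obtain f :: "'a \<Rightarrow> nat" where f: "card (f ` V) = k" "proper_colouring f B" by blast
  define cls where "cls c = {v \<in> V. f v = c}" for c
  have "inj_on cls (f ` V)"
    unfolding inj_on_def cls_def by blast
  then have "card (cls ` f ` V) = k"
    using f(1) by (simp add: card_image)
  moreover have "partition_on V (cls ` f ` V)"
    by (rule partition_onI) (auto simp: cls_def disjnt_def)
  moreover have "\<not> verts S \<subseteq> C" if "S \<in> B" "C \<in> cls ` f ` V" for S C
    using f(2) that unfolding proper_colouring_def cls_def by fastforce
  ultimately show "colourable k V B"
    unfolding colourable_def using \<open>finite V\<close> by blast
qed

text \<open>While there are fewer colours than vertices, two vertices share a colour, and one of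
  them can be given a fresh one. This never makes differently coloured vertices equal, so no star
  becomes monochromatic.\<close>

lemma proper_colouring_refine:
  fixes f :: "'a \<Rightarrow> nat"
  assumes "finite V" and B: "\<And>S. S \<in> B \<Longrightarrow> verts S \<subseteq> V"
    and "proper_colouring f B" and "card (f ` V) \<le> k" and "k \<le> card V"
  shows "\<exists>g :: 'a \<Rightarrow> nat. card (g ` V) = k \<and> proper_colouring g B"
  using assms(4,5)
proof (induction k rule: dec_induct)
  case base
  show ?case using assms(3) by blast
next
  case (step k)
  then obtain g :: "'a \<Rightarrow> nat" where g: "card (g ` V) = k" "proper_colouring g B" by auto
  have "\<not> inj_on g V"
    using g(1) step card_image[of g V] by auto
  then obtain u v where uv: "u \<in> V" "v \<in> V" "u \<noteq> v" "g u = g v" unfolding inj_on_def by blast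
  obtain c where c: "c \<notin> g ` V"
    using ex_new_if_finite[OF infinite_UNIV_nat] \<open>finite V\<close> by blast
  define g' where "g' = g(u := c)"
  \<comment> \<open>The old colour of \<open>u\<close> survives at \<open>v\<close>, so the number
    of colours grows by exactly one.\<close>
  have "g' ` V = insert c (g ` V)"
    using uv unfolding g'_def by (auto simp: image_iff)
  then have "card (g' ` V) = Suc k" using c \<open>finite V\<close> g(1) by simp
  moreover have "proper_colouring g' B"
    unfolding proper_colouring_def
  proof
    fix S assume S: "S \<in> B"
    then obtain a b where ab: "a \<in> verts S" "b \<in> verts S" "g a \<noteq> g b"
      using g(2) unfolding proper_colouring_def by blast
    with B[OF S] have "a \<in> V" "b \<in> V" by auto
    with c ab(3) have "g' a \<noteq> g' b" unfolding g'_def by auto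
    with ab show "\<exists>u\<in>verts S. \<exists>v\<in>verts S. g' u \<noteq> g' v" by blast
  qed
  ultimately show ?case by blast
qed

lemma star_system_verts:
  assumes "star_system e n V B" "S \<in> B"
  shows "verts S \<subseteq> V \<and> verts S \<noteq> {}"
proof -
  have "is_star e S" "subgraph S (complete_graph V)" using assms unfolding star_system_def by auto
  then show ?thesis
    unfolding is_star_def subgraph_def complete_graph_def complete_bipartite_graph_def by auto
qed

lemma star_system_colourable_iff:
  fixes V :: "'a set"
  assumes "star_system e n V B"
  shows "colourable k V B \<longleftrightarrow> (\<exists>f :: 'a \<Rightarrow> nat. card (f ` V) = k \<and> proper_colouring f B)"
  using assms star_system_verts[OF assms]
  by (intro colourable_iff_proper_colouring) (auto simp: star_system_def)

text \<open>A colouring of the larger system with \<open>k - 1\<close> colours restricts to the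
  smaller one. The restriction may lose colours, but it can be refined back to exactly
  \<open>k - 1\<close>, contradicting \<open>chr\<close>.\<close>

lemma chromatic_superset:
  fixes V V' :: "'a set" and f :: "'a \<Rightarrow> nat"
  assumes sys: "star_system e n V B" and sys': "star_system e n' V' B'"
    and "V \<subseteq> V'" and "B \<subseteq> B'" and chr: "chromatic k V B"
    and f: "card (f ` V') = k" "proper_colouring f B'"
  shows "chromatic k V' B'"
proof -
  have fin: "finite V" "finite V'" using sys sys' unfolding star_system_def by auto
  \<comment> \<open>A colouring that shows \<open>k\<close> colours on \<open>V\<close> forces at
    least \<open>k\<close> vertices, which gives the room that the refinement asks for.\<close>
  obtain h :: "'a \<Rightarrow> nat" where "card (h ` V) = k"
    using chr unfolding chromatic_def star_system_colourable_iff[OF sys] by blast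
  then have k: "k - 1 \<le> card V" using card_image_le[OF fin(1), of h] by simp
  have "\<not> colourable (k - 1) V' B'"
  proof
    assume "colourable (k - 1) V' B'"
    then obtain g :: "'a \<Rightarrow> nat" where g: "card (g ` V') = k - 1" "proper_colouring g B'"
      unfolding star_system_colourable_iff[OF sys'] by blast
    have "card (g ` V) \<le> k - 1"
      using g(1) card_mono[of "g ` V'" "g ` V"] fin \<open>V \<subseteq> V'\<close> by (simp add: image_mono)
    moreover have "proper_colouring g B"
      using g(2) \<open>B \<subseteq> B'\<close> unfolding proper_colouring_def by blast
    ultimately have "colourable (k - 1) V B"
      unfolding star_system_colourable_iff[OF sys]
      using proper_colouring_refine[OF fin(1), of B g] star_system_verts[OF sys] k by blast
    then show False using chr unfolding chromatic_def by blast
  qed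
  then show ?thesis
    using f unfolding chromatic_def star_system_colourable_iff[OF sys'] by blast
qed

section \<open>Isomorphic copies\<close>

definition map_sgraph :: "('a \<Rightarrow> 'b) \<Rightarrow> 'a sgraph \<Rightarrow> 'b sgraph" where
  "map_sgraph h G = (h ` verts G, (`) h ` edges G)"

lemma star_system_map:
  assumes sys: "star_system e n V B" and h: "inj_on h V"
  shows "star_system e n (h ` V) (map_sgraph h ` B)"
proof -
  have fin: "finite V" and card: "card V = n"
    and star: "\<And>S. S \<in> B \<Longrightarrow> is_star e S" and sub: "\<And>S. S \<in> B \<Longrightarrow> subgraph S (complete_graph V)"
    and disj: "disjoint_family_on edges B" and cover: "(\<Union>S\<in>B. edges S) = edges (complete_graph V)"
    using sys unfolding star_system_def by auto
  have edges_sub: "F \<subseteq> V" if "S \<in> B" "F \<in> edges S" for S F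
    using sub[OF that(1)] that(2) unfolding subgraph_def complete_graph_def by auto
  have edges_complete: "edges (complete_graph (h ` V)) = (`) h ` edges (complete_graph V)"
  proof (intro equalityI subsetI)
    fix F assume "F \<in> edges (complete_graph (h ` V))"
    then have F: "F \<subseteq> h ` V" "card F = 2" unfolding complete_graph_def by auto
    then obtain G where G: "G \<subseteq> V" "F = h ` G" by (auto simp: subset_image_iff)
    then have "card G = 2" using F card_image[of h G] inj_on_subset[OF h] by auto
    with G show "F \<in> (`) h ` edges (complete_graph V)" unfolding complete_graph_def by auto
  next
    fix F assume "F \<in> (`) h ` edges (complete_graph V)"
    then obtain G where G: "G \<subseteq> V" "card G = 2" "F = h ` G" unfolding complete_graph_def by auto
    then have "card F = 2" using card_image[of h G] inj_on_subset[OF h] by auto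
    with G show "F \<in> edges (complete_graph (h ` V))" unfolding complete_graph_def by auto
  qed
  have "is_star e (map_sgraph h S)" if S: "S \<in> B" for S
  proof -
    obtain c L where L: "c \<notin> L" "finite L" "card L = e" "S = complete_bipartite_graph {c} L"
      using star[OF S] unfolding is_star_def by blast
    have cL: "insert c L \<subseteq> V"
      using star_system_verts[OF sys S] L(4) unfolding complete_bipartite_graph_def by auto
    then have "h c \<notin> h ` L" using h L(1) unfolding inj_on_def by blast
    moreover have "card (h ` L) = e" using L(3) cL h
      by (meson card_image inj_on_subset subset_insertI order_trans)
    moreover have "map_sgraph h S = complete_bipartite_graph {h c} (h ` L)"
      unfolding L(4) map_sgraph_def complete_bipartite_graph_def by (auto simp: image_iff) blast
    ultimately show ?thesis unfolding is_star_def using L(2) by blast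
  qed
  moreover have "subgraph (map_sgraph h S) (complete_graph (h ` V))" if S: "S \<in> B" for S
  proof -
    have "edges (map_sgraph h S) \<subseteq> edges (complete_graph (h ` V))"
      unfolding edges_complete using sub[OF S] unfolding map_sgraph_def subgraph_def by auto
    then show ?thesis
      using star_system_verts[OF sys S]
      unfolding subgraph_def map_sgraph_def complete_graph_def by auto
  qed
  moreover have "disjoint_family_on edges (map_sgraph h ` B)"
    unfolding disjoint_family_on_def
  proof (intro ballI impI)
    fix S T assume "S \<in> map_sgraph h ` B" "T \<in> map_sgraph h ` B" and ne: "S \<noteq> T"
    then obtain S' T' where S': "S' \<in> B" "S = map_sgraph h S'" and T': "T' \<in> B" "T = map_sgraph h T'"
      by blast
    with ne have "S' \<noteq> T'" by metis
    with S'(1) T'(1) have d: "edges S' \<inter> edges T' = {}"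
      using disj by (simp add: disjoint_family_on_def)
    show "edges S \<inter> edges T = {}"
    proof (rule ccontr)
      assume "edges S \<inter> edges T \<noteq> {}"
      then obtain F G where "F \<in> edges S'" "G \<in> edges T'" "h ` F = h ` G"
        unfolding S' T' map_sgraph_def by auto
      moreover from this have "F = G"
        using edges_sub S' T' inj_on_image_eq_iff[OF h] by metis
      ultimately show False using d by blast
    qed
  qed
  moreover have "(\<Union>S\<in>map_sgraph h ` B. edges S) = edges (complete_graph (h ` V))"
    unfolding edges_complete cover[symmetric] map_sgraph_def by auto
  ultimately show ?thesis
    unfolding star_system_def using fin card card_image[OF h] by auto
qed

text \<open>Colourings are pulled back along \<open>h\<close> and pushed forward along its inverse
  on \<open>V\<close>; the stars only involve vertices of \<open>V\<close>, where \<open>h\<close>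
  is injective.\<close>

lemma colourable_map_iff:
  fixes V :: "'a set" and h :: "'a \<Rightarrow> 'b"
  assumes sys: "star_system e n V B" and h: "inj_on h V"
  shows "colourable k (h ` V) (map_sgraph h ` B) \<longleftrightarrow> colourable k V B"
  unfolding star_system_colourable_iff[OF sys] star_system_colourable_iff[OF star_system_map[OF sys h]]
proof
  assume "\<exists>f :: 'b \<Rightarrow> nat. card (f ` h ` V) = k \<and> proper_colouring f (map_sgraph h ` B)"
  then obtain f :: "'b \<Rightarrow> nat" where f: "card (f ` h ` V) = k" "proper_colouring f (map_sgraph h ` B)"
    by blast
  then have "card ((f \<circ> h) ` V) = k" "proper_colouring (f \<circ> h) B"
    unfolding proper_colouring_def map_sgraph_def by (auto simp: image_comp)
  then show "\<exists>f :: 'a \<Rightarrow> nat. card (f ` V) = k \<and> proper_colouring f B" by blast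
next
  assume "\<exists>f :: 'a \<Rightarrow> nat. card (f ` V) = k \<and> proper_colouring f B"
  then obtain f :: "'a \<Rightarrow> nat" where f: "card (f ` V) = k" "proper_colouring f B" by blast
  define g where "g = f \<circ> inv_into V h"
  have g: "g (h v) = f v" if "v \<in> V" for v
    using that h unfolding g_def by simp
  have "g ` h ` V = f ` V" using g by (auto simp: image_iff)
  moreover have "proper_colouring g (map_sgraph h ` B)"
    unfolding proper_colouring_def
  proof
    fix T assume "T \<in> map_sgraph h ` B"
    then obtain S where S: "S \<in> B" "T = map_sgraph h S" by blast
    then obtain u v where uv: "u \<in> verts S" "v \<in> verts S" "f u \<noteq> f v"
      using f(2) unfolding proper_colouring_def by blast
    moreover from this have "u \<in> V" "v \<in> V" using star_system_verts[OF sys S(1)] by auto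
    ultimately have "g (h u) \<noteq> g (h v)" by (simp add: g)
    with uv S(2) show "\<exists>u\<in>verts T. \<exists>v\<in>verts T. g u \<noteq> g v"
      unfolding map_sgraph_def by auto
  qed
  ultimately show "\<exists>f :: 'b \<Rightarrow> nat. card (f ` h ` V) = k \<and> proper_colouring f (map_sgraph h ` B)"
    using f(1) by metis
qed

text \<open>The given system may live on any type, even one without room for further vertices. On
  \<open>{..<n}\<close> the numbers from \<open>n\<close> on are always fresh.\<close>

lemma chromatic_star_system_lessThan:
  assumes sys: "star_system e n V B" and chr: "chromatic k V B"
  shows "\<exists>B'. star_system e n {..<n} B' \<and> chromatic k {..<n} B'"
proof -
  have "finite V" "card V = n" using sys unfolding star_system_def by auto
  then obtain h where h: "bij_betw h V {..<n}"
    using ex_bij_betw_finite_nat[of V] by (auto simp: atLeast0LessThan)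
  then have inj: "inj_on h V" and img: "h ` V = {..<n}" unfolding bij_betw_def by auto
  show ?thesis
    using star_system_map[OF sys inj] chr
    unfolding chromatic_def colourable_map_iff[OF sys inj, symmetric] img by blast
qed

section \<open>Adding new centres\<close>

text \<open>Each block takes one element of \<open>D\<close> and \<open>e - 1\<close> elements
  outside \<open>D\<close>; the size of \<open>A\<close> makes these come out even. The blocks will
  be the leaf sets of the stars at a new centre, with \<open>D\<close> supplying a leaf of another
  colour to each.\<close>

lemma partition_into_blocks_meeting:
  assumes "finite D" "finite A" "D \<subseteq> A" "card A = e * card D" "e > 0"
  shows "\<exists>Q. partition_on A Q \<and> (\<forall>q\<in>Q. card q = e \<and> q \<inter> D \<noteq> {})"
  using assms
proof (induction D arbitrary: A rule: finite_induct)
  case empty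
  then have "A = {}" by simp
  then show ?case by (auto simp: partition_on_def)
next
  case (insert d D)
  have "card (A - insert d D) = e * Suc (card D) - Suc (card D)"
    using insert by (simp add: card_Diff_subset)
  also have "\<dots> = (e - 1) * Suc (card D)" by (simp add: diff_mult_distrib del: mult_Suc_right)
  also have "\<dots> \<ge> e - 1" by simp
  finally obtain T where T: "T \<subseteq> A - insert d D" "card T = e - 1" "finite T"
    by (rule obtain_subset_with_card_n)
  define U where "U = insert d T"
  \<comment> \<open>The block uses no element of \<open>D\<close> besides \<open>d\<close>, so all
    of \<open>D\<close> is still available in \<open>A - U\<close> for the induction
    hypothesis.\<close>
  have U: "card U = e" "U \<subseteq> A" "U \<inter> D = {}" "finite U" "U \<noteq> {}"
    using T insert unfolding U_def by (auto simp: card_insert_if)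
  have "card (A - U) = e * card D"
    using U insert by (simp add: card_Diff_subset)
  moreover have "D \<subseteq> A - U" using insert U by blast
  ultimately obtain Q where Q: "partition_on (A - U) Q" "\<forall>q\<in>Q. card q = e \<and> q \<inter> D \<noteq> {}"
    using insert.IH[of "A - U"] insert.prems by auto
  have "disjnt U (\<Union>Q)" unfolding partition_onD1[OF Q(1), symmetric] disjnt_def by blast
  from partition_on_insert[OF this] Q(1) U have "partition_on A (insert U Q)" by blast
  moreover have "\<forall>q\<in>insert U Q. card q = e \<and> q \<inter> insert d D \<noteq> {}"
    using Q U unfolding U_def by auto
  ultimately show ?case by blast
qed

text \<open>Every vertex avoids at least one of two given colours, so the two sets of vertices
  avoiding them cover \<open>V\<close> and one of these sets has at least half the size of
  \<open>V\<close>.\<close>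

lemma minority_colour:
  fixes f :: "'a \<Rightarrow> 'c"
  assumes "finite V" "card (f ` V) \<ge> 2"
  shows "\<exists>c\<in>f ` V. card V \<le> 2 * card {v \<in> V. f v \<noteq> c}"
proof -
  obtain c1 c2 where c: "c1 \<in> f ` V" "c2 \<in> f ` V" "c1 \<noteq> c2"
    using assms(2) by (metis card_le_Suc0_iff_eq assms(1) finite_imageI not_less_eq_eq numeral_2_eq_2)
  let ?D = "\<lambda>c. {v \<in> V. f v \<noteq> c}"
  have "card V \<le> card (?D c1 \<union> ?D c2)"
    using assms(1) c(3) by (intro card_mono) auto
  also have "\<dots> \<le> card (?D c1) + card (?D c2)" by (rule card_Un_le)
  finally have "card V \<le> 2 * card (?D c1) \<or> card V \<le> 2 * card (?D c2)" by linarith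
  then show ?thesis using c by blast
qed

text \<open>\<open>N x\<close> is the out-neighbourhood of \<open>x\<close> in a tournament on
  \<open>X\<close>. An edge between \<open>X\<close> and \<open>V\<close> is centred at its end in
  \<open>X\<close>, an edge inside \<open>X\<close> at its tail; the blocks of \<open>Q x\<close>
  cut the edges centred at \<open>x\<close> into stars.\<close>

lemma star_system_add_centres:
  fixes V X :: "'a set"
  assumes sys: "star_system e n V B" and "finite X" "V \<inter> X = {}" "e > 0"
    and N: "\<And>x. x \<in> X \<Longrightarrow> N x \<subseteq> X - {x}"
    and tour: "\<And>x y. x \<in> X \<Longrightarrow> y \<in> X \<Longrightarrow> x \<noteq> y \<Longrightarrow> y \<in> N x \<longleftrightarrow> x \<notin> N y"
    and Q: "\<And>x. x \<in> X \<Longrightarrow> partition_on (V \<union> N x) (Q x)"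
    and Qe: "\<And>x q. x \<in> X \<Longrightarrow> q \<in> Q x \<Longrightarrow> card q = e"
  shows "star_system e (n + card X) (V \<union> X)
           (B \<union> {complete_bipartite_graph {x} q | x q. x \<in> X \<and> q \<in> Q x})"
    (is "star_system _ _ _ (B \<union> ?C)")
proof -
  let ?K = "complete_bipartite_graph :: 'a set \<Rightarrow> 'a set \<Rightarrow> 'a sgraph"
  have fin: "finite V" and card: "card V = n"
    and star: "\<And>S. S \<in> B \<Longrightarrow> is_star e S" and sub: "\<And>S. S \<in> B \<Longrightarrow> subgraph S (complete_graph V)"
    and disj: "disjoint_family_on edges B" and cover: "(\<Union>S\<in>B. edges S) = edges (complete_graph V)"
    using sys unfolding star_system_def by auto
  have edges_K: "edges (?K {x} q) = {{x, y} | y. y \<in> q}" for x q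
    unfolding complete_bipartite_graph_def by auto
  have q_sub: "q \<subseteq> V \<union> N x" if "x \<in> X" "q \<in> Q x" for x q
    using partition_onD1[OF Q[OF that(1)]] that(2) by blast
  have x_q: "x \<notin> q" if "x \<in> X" "q \<in> Q x" for x q
    using q_sub[OF that] N[OF that(1)] that(1) \<open>V \<inter> X = {}\<close> by blast
  have old_edge: "F \<subseteq> V" if "S \<in> B" "F \<in> edges S" for S F
    using sub[OF that(1)] that(2) unfolding subgraph_def complete_graph_def by auto
  have "is_star e S \<and> subgraph S (complete_graph (V \<union> X))" if "S \<in> B \<union> ?C" for S
    using that
  proof
    assume S: "S \<in> B"
    then show ?thesis using star[OF S] sub[OF S] unfolding subgraph_def complete_graph_def by auto
  next
    assume "S \<in> ?C"
    then obtain x q where S: "x \<in> X" "q \<in> Q x" "S = ?K {x} q" by blast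
    \<comment> \<open>An infinite set has \<open>card\<close> 0, so positivity of \<open>e\<close>
      is what yields finiteness.\<close>
    have "finite q" using Qe[OF S(1,2)] \<open>e > 0\<close> by (simp add: card_ge_0_finite)
    then have "is_star e S"
      unfolding is_star_def using S x_q[OF S(1,2)] Qe[OF S(1,2)] by blast
    moreover have "q \<subseteq> V \<union> X" using q_sub[OF S(1,2)] N[OF S(1)] by blast
    then have "subgraph S (complete_graph (V \<union> X))"
      unfolding subgraph_def complete_graph_def S(3) complete_bipartite_graph_def
      using S(1) x_q[OF S(1,2)] by (auto simp: card_2_iff)
    ultimately show ?thesis by blast
  qed
  moreover have "disjoint_family_on edges (B \<union> ?C)"
  proof -
    have old_new: "edges S \<inter> edges T = {}" if "S \<in> B" "T \<in> ?C" for S T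
      using that old_edge \<open>V \<inter> X = {}\<close> by (fastforce simp: edges_K)
    \<comment> \<open>With a common centre, a shared edge has the same leaf in both stars and hence
      the same block. With distinct centres, each would be an out-neighbour of the other.\<close>
    have new_new: "S = T" if "S \<in> ?C" "T \<in> ?C" and F: "F \<in> edges S" "F \<in> edges T" for S T F
    proof -
      obtain x q where S: "x \<in> X" "q \<in> Q x" "S = ?K {x} q" using \<open>S \<in> ?C\<close> by blast
      obtain x' q' where T: "x' \<in> X" "q' \<in> Q x'" "T = ?K {x'} q'" using \<open>T \<in> ?C\<close> by blast
      obtain y y' where y: "y \<in> q" "y' \<in> q'" "{x, y} = {x', y'}"
        using F unfolding S(3) T(3) edges_K by blast
      show ?thesis
      proof (cases "x = x'")
        case True
        with y have "y = y'" by (auto simp: doubleton_eq_iff)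
        with y True S T have "q = q'"
          using partition_onD2[OF Q[OF S(1)]] unfolding disjoint_def by blast
        with True S T show ?thesis by simp
      next
        case False
        with y have "x' \<in> q" "x \<in> q'" by (auto simp: doubleton_eq_iff)
        then have "x' \<in> N x" "x \<in> N x'"
          using q_sub S T \<open>V \<inter> X = {}\<close> by blast+
        with tour[OF S(1) T(1) False] show ?thesis by blast
      qed
    qed
    show ?thesis
      unfolding disjoint_family_on_def
    proof (intro ballI impI)
      fix S T assume "S \<in> B \<union> ?C" "T \<in> B \<union> ?C" "S \<noteq> T"
      then consider "S \<in> B" "T \<in> B" | "S \<in> B" "T \<in> ?C" | "T \<in> B" "S \<in> ?C" | "S \<in> ?C" "T \<in> ?C"
        by blast
      then show "edges S \<inter> edges T = {}"
      proof cases
        case 1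
        then show ?thesis using disj \<open>S \<noteq> T\<close> unfolding disjoint_family_on_def by blast
      next
        case 2
        then show ?thesis by (rule old_new)
      next
        case 3
        then show ?thesis using old_new by blast
      next
        case 4
        then show ?thesis using new_new \<open>S \<noteq> T\<close> by blast
      qed
    qed
  qed
  moreover have "(\<Union>S\<in>B \<union> ?C. edges S) = edges (complete_graph (V \<union> X))"
  proof (rule equalityI)
    show "(\<Union>S\<in>B \<union> ?C. edges S) \<subseteq> edges (complete_graph (V \<union> X))"
      using calculation(1) unfolding subgraph_def by blast
    show "edges (complete_graph (V \<union> X)) \<subseteq> (\<Union>S\<in>B \<union> ?C. edges S)"
    proof
      fix F assume "F \<in> edges (complete_graph (V \<union> X))"
      then obtain a b where ab: "F = {a, b}" "a \<noteq> b" "a \<in> V \<union> X" "b \<in> V \<union> X"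
        unfolding complete_graph_def by (auto simp: card_2_iff)
      have new: "{x, y} \<in> (\<Union>S\<in>B \<union> ?C. edges S)" if x: "x \<in> X" and y: "y \<in> V \<union> N x" for x y
      proof -
        obtain q where "q \<in> Q x" "y \<in> q" using y partition_onD1[OF Q[OF x]] by blast
        then have "?K {x} q \<in> ?C" "{x, y} \<in> edges (?K {x} q)" using x edges_K by auto
        then show ?thesis by blast
      qed
      consider "a \<in> V" "b \<in> V" | "a \<in> X" "b \<in> V \<union> N a" | "b \<in> X" "a \<in> V \<union> N b"
        using ab tour[of a b] by blast
      then show "F \<in> (\<Union>S\<in>B \<union> ?C. edges S)"
      proof cases
        case 1
        then have "F \<in> (\<Union>S\<in>B. edges S)"
          unfolding cover complete_graph_def using ab by (auto simp: card_2_iff)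
        then show ?thesis by blast
      next
        case 2
        then show ?thesis using new ab(1) by simp
      next
        case 3
        then show ?thesis using new[of b a] ab(1) by (simp add: insert_commute)
      qed
    qed
  qed
  moreover have "card (V \<union> X) = n + card X"
    using card_Un_disjoint[of V X] fin \<open>finite X\<close> \<open>V \<inter> X = {}\<close> card by simp
  ultimately show ?thesis
    unfolding star_system_def using fin \<open>finite X\<close> by blast
qed

text \<open>Each new vertex is the centre of \<open>s\<close> stars. If all new vertices get a
  colour \<open>c\<close> that at least \<open>s\<close> old vertices avoid, every new star can be
  given a leaf of another colour.\<close>

lemma chromatic_star_system_add_centres:
  fixes V X :: "'a set"
  assumes sys: "star_system e n V B" and chr: "chromatic k V B" and "k \<ge> 2" "e > 0"
    and X: "finite X" "V \<inter> X = {}"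
    and N: "\<And>x. x \<in> X \<Longrightarrow> N x \<subseteq> X - {x}"
    and tour: "\<And>x y. x \<in> X \<Longrightarrow> y \<in> X \<Longrightarrow> x \<noteq> y \<Longrightarrow> y \<in> N x \<longleftrightarrow> x \<notin> N y"
    and deg: "\<And>x. x \<in> X \<Longrightarrow> n + card (N x) = e * s" and s: "2 * s \<le> n + 1"
  shows "\<exists>B'. star_system e (n + card X) (V \<union> X) B' \<and> chromatic k (V \<union> X) B'"
proof -
  have fin: "finite V" and card: "card V = n"
    using sys unfolding star_system_def by auto
  obtain f :: "'a \<Rightarrow> nat" where f: "card (f ` V) = k" "proper_colouring f B"
    using chr unfolding chromatic_def star_system_colourable_iff[OF sys] by blast
  obtain c where c: "c \<in> f ` V" "n \<le> 2 * card {v \<in> V. f v \<noteq> c}"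
    using minority_colour[OF fin, of f] f(1) \<open>k \<ge> 2\<close> card by auto
  \<comment> \<open>Integrality is used: 2s is at most n + 1, hence at most one more than an even
    number bounding n.\<close>
  with s have "s \<le> card {v \<in> V. f v \<noteq> c}" by linarith
  then obtain D where D: "D \<subseteq> {v \<in> V. f v \<noteq> c}" "card D = s" "finite D"
    by (rule obtain_subset_with_card_n)
  have "\<exists>Q. partition_on (V \<union> N x) Q \<and> (\<forall>q\<in>Q. card q = e \<and> q \<inter> D \<noteq> {})" if x: "x \<in> X" for x
  proof (rule partition_into_blocks_meeting)
    have "finite (N x)" "V \<inter> N x = {}" using N[OF x] X by (auto intro: finite_subset)
    then show "finite (V \<union> N x)" "card (V \<union> N x) = e * card D"
      using fin card deg[OF x] D(2) by (auto simp: card_Un_disjoint)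
  qed (use D \<open>e > 0\<close> in auto)
  then obtain Q where Q: "\<And>x. x \<in> X \<Longrightarrow> partition_on (V \<union> N x) (Q x)"
    and Qe: "\<And>x q. x \<in> X \<Longrightarrow> q \<in> Q x \<Longrightarrow> card q = e"
    and QD: "\<And>x q. x \<in> X \<Longrightarrow> q \<in> Q x \<Longrightarrow> q \<inter> D \<noteq> {}"
    by metis
  define C where "C = {complete_bipartite_graph {x} q | x q. x \<in> X \<and> q \<in> Q x}"
  have sys': "star_system e (n + card X) (V \<union> X) (B \<union> C)"
    unfolding C_def by (rule star_system_add_centres[OF sys X \<open>e > 0\<close> N tour Q Qe])
  define g where "g v = (if v \<in> V then f v else c)" for v
  \<comment> \<open>\<open>c\<close> already occurs on \<open>V\<close>, so the new vertices bring
    no further colour.\<close>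
  have "g ` (V \<union> X) = f ` V" using c(1) X(2) unfolding g_def by auto
  then have "card (g ` (V \<union> X)) = k" using f(1) by simp
  moreover have "proper_colouring g (B \<union> C)"
    unfolding proper_colouring_def
  proof
    fix S assume "S \<in> B \<union> C"
    then show "\<exists>u\<in>verts S. \<exists>v\<in>verts S. g u \<noteq> g v"
    proof
      assume S: "S \<in> B"
      then obtain u v where uv: "u \<in> verts S" "v \<in> verts S" "f u \<noteq> f v"
        using f(2) unfolding proper_colouring_def by blast
      with star_system_verts[OF sys S] have "g u \<noteq> g v" unfolding g_def by auto
      with uv show ?thesis by blast
    next
      assume "S \<in> C"
      then obtain x q where S: "x \<in> X" "q \<in> Q x" "S = complete_bipartite_graph {x} q"
        unfolding C_def by blast
      obtain d where d: "d \<in> q" "d \<in> D" using QD[OF S(1,2)] by blast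
      then have "g d \<noteq> c" using D(1) unfolding g_def by auto
      moreover have "g x = c" using S(1) X(2) unfolding g_def by auto
      ultimately have "g x \<noteq> g d" by simp
      then show ?thesis using d(1) unfolding S(3) complete_bipartite_graph_def by auto
    qed
  qed
  ultimately have "chromatic k (V \<union> X) (B \<union> C)"
    using chromatic_superset[OF sys sys' _ _ chr] by blast
  with sys' show ?thesis by blast
qed

section \<open>Regular tournaments\<close>

text \<open>This is the rotational tournament on the residues modulo 2m + 1: each vertex beats its
  \<open>m\<close> cyclic successors. The modulus is odd, so of a nonzero difference and its
  negative exactly one lies in 1, ..., m. The vertices start at \<open>n\<close> to avoid
  \<open>{..<n}\<close>.\<close>

lemma regular_tournament_shifted:
  fixes m n :: nat
  defines "X \<equiv> {n..<n + (2 * m + 1)}"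
  shows "\<exists>N. (\<forall>x\<in>X. N x \<subseteq> X - {x} \<and> card (N x) = m)
           \<and> (\<forall>x\<in>X. \<forall>y\<in>X. x \<noteq> y \<longrightarrow> (y \<in> N x \<longleftrightarrow> x \<notin> N y))"
proof -
  \<comment> \<open>The second disjunct is the wrap-around: y + 2m + 1 is at most x + m exactly if y
    + m < x.\<close>
  define N where "N x = {y \<in> X. (x < y \<and> y \<le> x + m) \<or> y + m < x}" for x
  have "card (N x) = m" if x: "x \<in> X" for x
  proof (cases "x \<le> n + m")
    case True
    then have "N x = {x<..x + m}" using x unfolding N_def X_def by auto
    then show ?thesis by simp
  next
    case False
    then have "N x = {x<..n + 2 * m} \<union> {n..<x - m}" using x unfolding N_def X_def by auto
    moreover have "card ({x<..n + 2 * m} \<union> {n..<x - m}) = (n + 2 * m - x) + (x - m - n)"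
      by (subst card_Un_disjoint) auto
    ultimately show ?thesis using False x unfolding X_def by auto
  qed
  moreover have "N x \<subseteq> X - {x}" for x unfolding N_def by auto
  moreover have "\<forall>x\<in>X. \<forall>y\<in>X. x \<noteq> y \<longrightarrow> (y \<in> N x \<longleftrightarrow> x \<notin> N y)"
    unfolding N_def by auto
  ultimately show ?thesis by (intro exI[of _ N] conjI ballI) blast+
qed

section \<open>Induction over the admissible orders\<close>

theorem theorem3p2:
  fixes k e n0 :: nat
  assumes "k \<ge> 2" and "e \<ge> 3"
    and "[n0 = 0] (mod 2 * e) \<or> [n0 = 1] (mod 2 * e)"
    and "\<exists>(V0 :: 'a set) B0. star_system e n0 V0 B0 \<and> chromatic k V0 B0"
  shows "\<forall>n > n0. [n = 0] (mod 2 * e) \<or> [n = 1] (mod 2 * e) \<longrightarrow>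
           (\<exists>(V :: nat set) B. star_system e n V B \<and> chromatic k V B)"
proof -
  define P where "P n \<longleftrightarrow> (\<exists>B. star_system e n {..<n} B \<and> chromatic k {..<n} B)" for n :: nat
  \<comment> \<open>With 2m + 1 new vertices, each new centre has n + m leaves, cut into
    \<open>s\<close> stars.\<close>
  have step: "P (n + (2 * m + 1))" if "P n" "n + m = e * s" "2 * s \<le> n + 1" for n m s
  proof -
    obtain B where B: "star_system e n {..<n} B" "chromatic k {..<n} B"
      using \<open>P n\<close> unfolding P_def by blast
    let ?X = "{n..<n + (2 * m + 1)}"
    obtain N where N: "\<And>x. x \<in> ?X \<Longrightarrow> N x \<subseteq> ?X - {x}" "\<And>x. x \<in> ?X \<Longrightarrow> card (N x) = m"
      "\<And>x y. x \<in> ?X \<Longrightarrow> y \<in> ?X \<Longrightarrow> x \<noteq> y \<Longrightarrow> y \<in> N x \<longleftrightarrow> x \<notin> N y"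
      using regular_tournament_shifted[of n m] by metis
    have "\<exists>B'. star_system e (n + card ?X) ({..<n} \<union> ?X) B' \<and> chromatic k ({..<n} \<union> ?X) B'"
    proof (rule chromatic_star_system_add_centres[OF B])
      show "n + card (N x) = e * s" if "x \<in> ?X" for x
        using N(2)[OF that] \<open>n + m = e * s\<close> by simp
    qed (fact \<open>k \<ge> 2\<close> N that | use \<open>e \<ge> 3\<close> in force)+
    moreover have "{..<n} \<union> ?X = {..<n + (2 * m + 1)}" by auto
    ultimately show ?thesis unfolding P_def by simp
  qed
  \<comment> \<open>A single new vertex (m = 0) has 2et leaves and so s = 2t stars.\<close>
  have step0: "P (2 * e * t + 1)" if "P (2 * e * t)" for t
    using step[OF that, of 0 "2 * t"] mult_le_mono1[OF \<open>e \<ge> 3\<close>, of t] by simp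
  \<comment> \<open>Here m = e - 1 and s = 2t + 1. The bound on \<open>s\<close> reads 4t + 2 \<le>
    2et + 2, which is an equality at t = 0; this is why \<open>step\<close> allows n + 1
    there.\<close>
  have step1: "P (2 * e * Suc t)" if "P (2 * e * t + 1)" for t
  proof -
    have "P (2 * e * t + 1 + (2 * (e - 1) + 1))"
      using \<open>e \<ge> 3\<close> mult_le_mono1[OF \<open>e \<ge> 3\<close>, of t]
      by (intro step[OF that, of _ "2 * t + 1"]) (auto simp: algebra_simps)
    moreover have "2 * e * t + 1 + (2 * (e - 1) + 1) = 2 * e * Suc t"
      using \<open>e \<ge> 3\<close> by (simp add: algebra_simps)
    ultimately show ?thesis by metis
  qed
  have steps: "P (2 * e * t)" if "P (2 * e * t0)" "t0 \<le> t" for t0 t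
    using that(2,1) by (induction t rule: dec_induct) (use step0 step1 in blast)+
  have decomp: "\<exists>t. n = 2 * e * t \<or> n = 2 * e * t + 1"
    if "[n = 0] (mod 2 * e) \<or> [n = 1] (mod 2 * e)" for n
  proof -
    have "n mod (2 * e) = 0 \<or> n mod (2 * e) = 1"
      using that \<open>e \<ge> 3\<close> unfolding cong_def by auto
    then show ?thesis by (metis add_0_right mult_div_mod_eq)
  qed
  have "P n0"
    using assms(4) chromatic_star_system_lessThan unfolding P_def by blast
  have "P n" if n: "n > n0" "[n = 0] (mod 2 * e) \<or> [n = 1] (mod 2 * e)" for n
  proof -
    obtain t where t: "n = 2 * e * t \<or> n = 2 * e * t + 1" using decomp[OF n(2)] by blast
    obtain t0 where t0: "n0 = 2 * e * t0 \<or> n0 = 2 * e * t0 + 1" using decomp[OF assms(3)] by blast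
    \<comment> \<open>It suffices to reach the multiple of 2e; if \<open>n\<close> is one larger, a
      last \<open>step0\<close> follows.\<close>
    have "P (2 * e * t)"
    proof (cases "n0 = 2 * e * t0")
      case True
      \<comment> \<open>Here \<open>t0\<close> may equal \<open>t\<close>: then n = n0 + 1, and no
        full round is needed.\<close>
      have "2 * e * t0 < 2 * e * Suc t" using True t n(1) \<open>e \<ge> 3\<close> by (simp only: mult_Suc_right) linarith
      then have "t0 \<le> t" by (simp only: mult_less_cancel1) simp
      with steps \<open>P n0\<close> True show ?thesis by blast
    next
      case False
      \<comment> \<open>Now n > n0 forces t0 < t, so there is room to move up to the next multiple
        of 2e first.\<close>
      with t0 have n0: "n0 = 2 * e * t0 + 1" by blast
      then have "2 * e * t0 < 2 * e * t" using t n(1) by linarith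
      then have "Suc t0 \<le> t" by simp
      moreover have "P (2 * e * Suc t0)" using step1 \<open>P n0\<close> n0 by blast
      ultimately show ?thesis using steps by blast
    qed
    with step0 t show ?thesis by blast
  qed
  then show ?thesis unfolding P_def by blast
qed

end
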